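(* Let $G$ be a traceable graph and let $\ell$ be a positive integer. Then $pc_{1,\ell}(G)\leq \ell+1$. In particular, $pc_{1,2}(G)\leq 3$.
   Context: All graphs are finite, undirected, simple and connected. A graph is traceable if it contains a Hamiltonian path. An edge-coloring of a graph is an arbitrary map from its edge set to the natural numbers (adjacent edges may share a color). In an edge-colored graph, a path $P$ is a distance $\ell$-proper path if no two edges of $P$ of the same color appear with fewer than $\ell$ edges in between on $P$. The number $pc_{1,\ell}(G)$ is the minimum number of colors in an edge-coloring of $G$ such that every pair of distinct vertices of $G$ is connected by at least one distance $\ell$-proper path. *)

theory Defs
  imports Main
begin

text \<open>A graph is given by its vertex set \<open>V\<close> and its set \<open>E\<close> of edges, each edge being a
  two-element set of vertices.\<close>

definition simple_graph :: "'a set \<Rightarrow> 'a set set \<Rightarrow> bool" where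
  "simple_graph V E \<longleftrightarrow> finite V \<and> (\<forall>e\<in>E. e \<subseteq> V \<and> card e = 2)"

definition is_path :: "'a set \<Rightarrow> 'a set set \<Rightarrow> 'a list \<Rightarrow> bool" where
  "is_path V E p \<longleftrightarrow> p \<noteq> [] \<and> distinct p \<and> set p \<subseteq> V \<and>
     (\<forall>i. Suc i < length p \<longrightarrow> {p ! i, p ! Suc i} \<in> E)"

definition path_between :: "'a set \<Rightarrow> 'a set set \<Rightarrow> 'a \<Rightarrow> 'a list \<Rightarrow> 'a \<Rightarrow> bool" where
  "path_between V E u p v \<longleftrightarrow> is_path V E p \<and> hd p = u \<and> last p = v"

definition connected_graph :: "'a set \<Rightarrow> 'a set set \<Rightarrow> bool" where
  "connected_graph V E \<longleftrightarrow> V \<noteq> {} \<and> (\<forall>u\<in>V. \<forall>v\<in>V. \<exists>p. path_between V E u p v)"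

definition traceable :: "'a set \<Rightarrow> 'a set set \<Rightarrow> bool" where
  "traceable V E \<longleftrightarrow> (\<exists>p. is_path V E p \<and> set p = V)"

text \<open>The \<open>i\<close>-th edge of a path \<open>p\<close> is \<open>{p ! i, p ! Suc i}\<close>; strictly between its \<open>i\<close>-th and
  \<open>j\<close>-th edges, where \<open>i < j\<close>, there are \<open>j - i - 1\<close> edges.\<close>

definition distance_proper :: "nat \<Rightarrow> ('a set \<Rightarrow> nat) \<Rightarrow> 'a list \<Rightarrow> bool" where
  "distance_proper l c p \<longleftrightarrow>
     \<not> (\<exists>i j. i < j \<and> Suc j < length p \<and>
            c {p ! i, p ! Suc i} = c {p ! j, p ! Suc j} \<and> j - i - 1 < l)"

text \<open>Only the values of a coloring on \<open>E\<close> matter.\<close>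

definition distance_proper_connected ::
    "nat \<Rightarrow> 'a set \<Rightarrow> 'a set set \<Rightarrow> ('a set \<Rightarrow> nat) \<Rightarrow> bool" where
  "distance_proper_connected l V E c \<longleftrightarrow>
     (\<forall>u\<in>V. \<forall>v\<in>V. u \<noteq> v \<longrightarrow> (\<exists>p. path_between V E u p v \<and> distance_proper l c p))"

definition pc1 :: "nat \<Rightarrow> 'a set \<Rightarrow> 'a set set \<Rightarrow> nat" where
  "pc1 l V E = (LEAST k. \<exists>c. distance_proper_connected l V E c \<and> card (c ` E) = k)"

text \<open>For finite connected graphs the minimum in \<open>pc1\<close> ranges over a nonempty set, so it is
  attained.\<close>

lemma distance_proper_connected_exists:
  fixes V :: "'a set" and E :: "'a set set" and l :: nat
  assumes "simple_graph V E" and "connected_graph V E"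
  shows "\<exists>c. distance_proper_connected l V E c"
proof -
  have "finite V" "E \<subseteq> Pow V"
    using assms(1) by (auto simp: simple_graph_def)
  then have "finite E"
    by (meson finite_Pow_iff finite_subset)
  then obtain c :: "'a set \<Rightarrow> nat" where c: "inj_on c E"
    using finite_imp_inj_to_nat_seg by metis
  have "distance_proper l c p" if p: "is_path V E p" for p
    unfolding distance_proper_def
  proof clarify
    fix i j
    assume ij: "i < j" "Suc j < length p"
      and eq: "c {p ! i, p ! Suc i} = c {p ! j, p ! Suc j}"
    have "{p ! i, p ! Suc i} \<in> E" "{p ! j, p ! Suc j} \<in> E"
      using p ij by (auto simp: is_path_def)
    with c eq have "{p ! i, p ! Suc i} = {p ! j, p ! Suc j}"
      by (auto dest: inj_onD)
    then have "p ! i = p ! j \<or> p ! i = p ! Suc j"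
      by auto
    moreover have "distinct p"
      using p by (simp add: is_path_def)
    ultimately show False
      using ij by (auto simp: nth_eq_iff_index_eq)
  qed
  then have "distance_proper_connected l V E c"
    using assms(2) unfolding distance_proper_connected_def connected_graph_def path_between_def
    by blast
  then show ?thesis by blast
qed

lemma pc1_attained:
  fixes V :: "'a set" and E :: "'a set set" and l :: nat
  assumes "simple_graph V E" and "connected_graph V E"
  shows "\<exists>c. distance_proper_connected l V E c \<and> card (c ` E) = pc1 l V E"
  unfolding pc1_def
  by (rule LeastI_ex) (use distance_proper_connected_exists[OF assms, of l] in blast)

end

theory Submission imports Defs begin

text \<open>Color the \<open>i\<close>-th edge of a Hamiltonian path with \<open>i mod (l + 1)\<close> and every other edge with
  any of these \<open>l + 1\<close> colors. Two edges of the same color on the Hamiltonian path have at least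
  \<open>l\<close> edges in between, so each segment of it is a distance \<open>l\<close>-proper path joining its ends.\<close>

lemma pc1_le:
  assumes "distance_proper_connected l V E c"
  shows "pc1 l V E \<le> card (c ` E)"
  unfolding pc1_def by (rule Least_le) (use assms in blast)

lemma is_path_segment:
  assumes "is_path V E p" "a \<le> b" "b < length p"
  shows "is_path V E (drop a (take (Suc b) p))"
  using assms by (auto simp: is_path_def dest: in_set_dropD in_set_takeD)

text \<open>Edge \<open>i\<close> of the segment is edge \<open>a + i\<close> of \<open>p\<close>,
  and this shift preserves the number of edges in between.\<close>

lemma distance_proper_segment:
  assumes "distance_proper l c p"
  shows "distance_proper l c (drop a (take b p))"
  unfolding distance_proper_def
proof clarify
  fix i j
  assume ij: "i < j" "Suc j < length (drop a (take b p))" "j - i - 1 < l"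
    and eq: "c {drop a (take b p) ! i, drop a (take b p) ! Suc i}
           = c {drop a (take b p) ! j, drop a (take b p) ! Suc j}"
  \<comment> \<open>The segment contains an edge, so \<open>drop a\<close> does not run past the end
    and its entries can be read off from \<open>p\<close>.\<close>
  have "a \<le> length (take b p)"
    using ij by auto
  then have "c {p ! (a + i), p ! Suc (a + i)} = c {p ! (a + j), p ! Suc (a + j)}"
    using ij eq by simp
  moreover have "a + i < a + j" "Suc (a + j) < length p" "(a + j) - (a + i) - 1 < l"
    using ij by auto
  ultimately show False
    using assms unfolding distance_proper_def by blast
qed

text \<open>The edges of \<open>p\<close> are numbered from 0 to \<open>length p - 2\<close>, and
  reversal mirrors this range. It also swaps the two ends of each edge, which the set does not
  see.\<close>

lemma rev_edge:
  assumes "Suc i < length p"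
  shows "{rev p ! i, rev p ! Suc i}
       = {p ! (length p - 2 - i), p ! Suc (length p - 2 - i)}"
proof -
  have "rev p ! i = p ! Suc (length p - 2 - i)" "rev p ! Suc i = p ! (length p - 2 - i)"
    using assms by (auto simp: rev_nth intro!: arg_cong[where f = "nth p"])
  then show ?thesis
    by (metis insert_commute)
qed

lemma is_path_rev:
  assumes "is_path V E p"
  shows "is_path V E (rev p)"
  using assms by (auto simp: is_path_def rev_edge)

lemma distance_proper_rev:
  assumes "distance_proper l c p"
  shows "distance_proper l c (rev p)"
  unfolding distance_proper_def
proof clarify
  fix i j
  assume ij: "i < j" "Suc j < length (rev p)" "j - i - 1 < l"
    and eq: "c {rev p ! i, rev p ! Suc i} = c {rev p ! j, rev p ! Suc j}"
  \<comment> \<open>Mirroring reverses the order of the two edges but keeps their index difference: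
    \<open>?i - ?j = j - i\<close>.\<close>
  let ?i = "length p - 2 - i" and ?j = "length p - 2 - j"
  have "?j < ?i" "Suc ?i < length p" "?i - ?j - 1 < l"
    using ij by auto
  moreover have "c {p ! ?j, p ! Suc ?j} = c {p ! ?i, p ! Suc ?i}"
    using ij eq by (simp add: rev_edge)
  ultimately show False
    using assms unfolding distance_proper_def by blast
qed

lemma distance_proper_connected_if_hamiltonian:
  assumes path: "is_path V E p" and V: "set p = V" and proper: "distance_proper l c p"
  shows "distance_proper_connected l V E c"
proof -
  let ?seg = "\<lambda>a b. drop a (take (Suc b) p)"
  have seg: "path_between V E (p ! a) (?seg a b) (p ! b)"
    if "a < b" "b < length p" for a b
    using is_path_segment[OF path, of a b] that
    by (simp add: path_between_def hd_drop_conv_nth last_conv_nth)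
  have "\<exists>q. path_between V E (p ! a) q (p ! b) \<and> distance_proper l c q"
    if "a < length p" "b < length p" "a \<noteq> b" for a b
  proof (cases "a < b")
    case True
    then show ?thesis
      using seg[of a b] distance_proper_segment[OF proper] that by blast
  next
    \<comment> \<open>Here \<open>b < a\<close>, so the segment runs from \<open>p ! b\<close> to
      \<open>p ! a\<close> and has to be traversed backwards.\<close>
    case False
    then have "path_between V E (p ! a) (rev (?seg b a)) (p ! b)"
      using seg[of b a] that
      by (metis hd_rev is_path_rev last_rev linorder_neqE_nat path_between_def)
    then show ?thesis
      using distance_proper_rev[OF distance_proper_segment[OF proper]] by blast
  qed
  then show ?thesis
    unfolding distance_proper_connected_def V[symmetric] by (metis in_set_conv_nth)
qed

lemma distance_proper_if_mod:
  assumes color: "\<And>i. Suc i < length p \<Longrightarrow> c {p ! i, p ! Suc i} = i mod (l + 1)"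
  shows "distance_proper l c p"
  unfolding distance_proper_def
proof clarify
  fix i j
  assume ij: "i < j" "Suc j < length p" "j - i - 1 < l"
    and eq: "c {p ! i, p ! Suc i} = c {p ! j, p ! Suc j}"
  have "j mod (l + 1) = i mod (l + 1)"
    using eq ij color by simp
  then have "l + 1 dvd j - i"
    using ij by (simp add: mod_eq_dvd_iff_nat)
  \<comment> \<open>A positive multiple of \<open>l + 1\<close> is at least \<open>l + 1\<close>,
    which leaves at least \<open>l\<close> edges in between.\<close>
  then have "l + 1 \<le> j - i"
    using ij by (simp add: dvd_imp_le)
  then show False
    using ij by simp
qed

lemma pc1_traceable_le:
  assumes "traceable V E"
  shows "pc1 l V E \<le> l + 1"
proof -
  obtain p where path: "is_path V E p" and V: "set p = V"
    using assms unfolding traceable_def by blast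
  \<comment> \<open>A color depends on the edge as a set, so the index of a path edge is recovered
    as the first position on \<open>p\<close> of one of its ends. The outer \<open>mod\<close> keeps
    the color of every other set below \<open>l + 1\<close> too.\<close>
  define c where "c e = (LEAST i. p ! i \<in> e) mod (l + 1)" for e
  have "c {p ! i, p ! Suc i} = i mod (l + 1)" if "Suc i < length p" for i
  proof -
    have "(LEAST k. p ! k \<in> {p ! i, p ! Suc i}) = i"
    proof (rule Least_equality)
      fix k assume k: "p ! k \<in> {p ! i, p ! Suc i}"
      show "i \<le> k"
      proof (rule ccontr)
        \<comment> \<open>Now \<open>k < i\<close> is a valid position of \<open>p\<close>, and
          distinctness rules out that \<open>p ! k\<close> is \<open>p ! i\<close> or
          \<open>p ! Suc i\<close>.\<close>
        assume "\<not> i \<le> k"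
        then show False
          using k path that by (auto simp: is_path_def nth_eq_iff_index_eq)
      qed
    qed simp
    then show ?thesis by (simp add: c_def)
  qed
  then have "distance_proper_connected l V E c"
    using distance_proper_connected_if_hamiltonian[OF path V] distance_proper_if_mod by blast
  then have "pc1 l V E \<le> card (c ` E)"
    by (rule pc1_le)
  also have "\<dots> \<le> card {..<l + 1}"
    by (rule card_mono) (auto simp: c_def)
  finally show ?thesis by simp
qed

theorem proposition2p3:
  fixes V :: "'a set" and E :: "'a set set" and l :: nat
  assumes "simple_graph V E" and "connected_graph V E"
    and "traceable V E" and "l \<ge> 1"
  shows "pc1 l V E \<le> l + 1 \<and> pc1 2 V E \<le> 3"
  using pc1_traceable_le[OF assms(3), of l] pc1_traceable_le[OF assms(3), of 2] by simp

end
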